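(* Consider the principal problem, the Bellman operators, the value iteration $V_0,V_1,\dots$ and the periodic operators $\mathcal B^\tau$ and $\bar{\mathcal B}_{\bar\eta,\tau}$ described in the context. (i) If there exist a real-valued function $\bar V$ of $(z,r)$ and a positive integer $\tau$ such that $\bar V\ge V_0$ and $\mathcal B^\tau\bar V\le\bar V$, then the value iteration $V_0,V_1,\dots$ converges to a limit $V_\star\le\bar V$. (ii) If there exists a $\tau$-periodic control law $\bar\eta$ such that $\bar V\ge V_0$ and $\bar{\mathcal B}_{\bar\eta,\tau}\bar V\le\bar V$, then $\mathcal B^\tau\bar V\le\bar V$, and the policy $\bar\eta$ achieves a cost $\sup_{H\in\mathcal M,d,N}\hat J^N_{\bar\eta}(z_0,H,d)$ no greater than $$\max\{\bar V(z_0,0),\ \mathcal B_{\bar\eta_\tau}\bar V(z_0,0),\ \dots,\ \mathcal B_{\bar\eta_2}\cdots\mathcal B_{\bar\eta_\tau}\bar V(z_0,0)\},$$ where $(\bar\eta_1,\dots,\bar\eta_\tau)=\bar\eta(z_0,0)$.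
   Context: Notation: $\mathbb S^n$ is the space of real symmetric $n\times n$ matrices. For a symmetric block matrix $H$, $\sigma_H(x_1,\dots,x_m)=\sum_{i,j}x_i^{\mathsf T}H^{ij}x_j$. For $H$ with blocks indexed by $z,u,d$ and $H^{dd}$ invertible, $H/H^{dd}$ is the Schur complement, with $(a,b)$ block $H^{ab}-H^{ad}(H^{dd})^{-1}H^{db}$, $a,b\in\{z,u\}$. Principal problem. Data: $\hat A\in\mathbb R^{n_z\times n_z}$, $\hat B\in\mathbb R^{n_z\times n_u}$, $\hat G\in\mathbb R^{n_z\times n_d}$, $z_0\in\mathbb R^{n_z}$, and a (nonempty) compact set $\mathcal M\subset\mathbb S^{n_z+n_u+n_d}$ whose members satisfy $H^{dd}\prec 0$, $H/H^{dd}\succeq 0$, $[H/H^{dd}]^{uu}\succ 0$. Dynamics and policy: $z_{t+1}=\hat Az_t+\hat Bu_t+\hat Gd_t$, $u_t=\mu_t(z_0,\dots,z_t,u_0,\dots,u_{t-1},d_0,\dots,d_{t-1})$. Cost: $\hat J^N_\mu(z_0,H,d)=\sum_{t=0}^{N-1}\sigma_H(z_t,u_t,d_t)$; value $\inf_\mu\sup_{H\in\mathcal M,d,N\ge0}\hat J^N_\mu(z_0,H,d)$. Information state: $r_t(H)=\sum_{s=0}^{t-1}\sigma_H(z_s,u_s,d_s)$ for $H\in\mathcal M$, so $r_0=0$, $r_{t+1}=f(r_t,z_t,u_t,d_t)$ with $f(r,z,u,d)(H)=r(H)+\sigma_H(z,u,d)$. Bellman operators: for functions $V$ of $(z,r)$,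 $z\in\mathbb R^{n_z}$, $r:\mathcal M\to\mathbb R$ continuous, $\mathcal B_uV(z,r)=\max_dV(\hat Az+\hat Bu+\hat Gd,f(r,z,u,d))$, $\mathcal BV(z,r)=\min_u\mathcal B_uV(z,r)$ (max and min understood as sup and inf in the extended reals). For a control law $\eta$, a function of $(z,r)$ with values in $\mathbb R^{n_u}$, $\mathcal B_\eta V(z,r)=\mathcal B_{\eta(z,r)}V(z,r)$. Value iteration: $V_0(z,r)=\max_{H\in\mathcal M}r(H)$, $V_{k+1}=\mathcal BV_k$. Inequalities and convergence (to a finite limit) are pointwise. $\tau$-periodic control law: a supervisor $\bar\eta$ mapping each $(z,r)$ to a $\tau$-tuple $(\bar\eta_1,\dots,\bar\eta_\tau)$ of control laws $\bar\eta_s:(z,r)\mapsto u\in\mathbb R^{n_u}$. The resulting policy evaluates $\bar\eta(z_{\tau k},r_{\tau k})=(\bar\eta_1,\dots,\bar\eta_\tau)$ at times $\tau k$, $k=0,1,\dots$, and applies $u_{\tau k+s}=\bar\eta_{s+1}(z_{\tau k+s},r_{\tau k+s})$ for $s=0,\dots,\tau-1$. Periodic operators: $\mathcal B^\tau$ is the $\tau$-fold composition of $\mathcal B$, and $\bar{\mathcal B}_{\bar\eta,\tau}\bar V(z,r)=\mathcal B_{\bar\eta_1}\mathcal B_{\bar\eta_2}\cdots\mathcal B_{\bar\eta_\tau}\bar V(z,r)$ with $(\bar\eta_1,\dots,\bar\eta_\tau)=\bar\eta(z,r)$. *)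

theory Defs
  imports "HOL-Analysis.Analysis"
begin

section \<open>Block matrices\<close>

text \<open>The block structure is carried by the index type \<open>('z + 'u) + 'd\<close>; this nesting makes
  the Schur complement with respect to the \<open>d\<close> block a matrix indexed by \<open>'z + 'u\<close>.\<close>

type_synonym ('z, 'u, 'd) block_matrix = "real^(('z + 'u) + 'd)^(('z + 'u) + 'd)"

definition subblock :: "('a \<Rightarrow> 'i) \<Rightarrow> ('b \<Rightarrow> 'j) \<Rightarrow> real^'j^'i \<Rightarrow> real^'b^'a"
  where "subblock f g H = (\<chi> i j. H $ f i $ g j)"

abbreviation zI :: "'z \<Rightarrow> ('z + 'u) + 'd" where "zI \<equiv> \<lambda>i. Inl (Inl i)"
abbreviation uI :: "'u \<Rightarrow> ('z + 'u) + 'd" where "uI \<equiv> \<lambda>i. Inl (Inr i)"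
abbreviation dI :: "'d \<Rightarrow> ('z + 'u) + 'd" where "dI \<equiv> Inr"

definition sigma ::
  "('z::finite, 'u::finite, 'd::finite) block_matrix \<Rightarrow> real^'z \<Rightarrow> real^'u \<Rightarrow> real^'d \<Rightarrow> real"
  where "sigma H z u d =
      z \<bullet> (subblock zI zI H *v z) + z \<bullet> (subblock zI uI H *v u) + z \<bullet> (subblock zI dI H *v d)
    + u \<bullet> (subblock uI zI H *v z) + u \<bullet> (subblock uI uI H *v u) + u \<bullet> (subblock uI dI H *v d)
    + d \<bullet> (subblock dI zI H *v z) + d \<bullet> (subblock dI uI H *v u) + d \<bullet> (subblock dI dI H *v d)"

definition pos_semidef :: "real^'n^'n \<Rightarrow> bool"
  where "pos_semidef P \<longleftrightarrow> transpose P = P \<and> (\<forall>x. 0 \<le> x \<bullet> (P *v x))"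

definition pos_def :: "real^'n^'n \<Rightarrow> bool"
  where "pos_def P \<longleftrightarrow> transpose P = P \<and> (\<forall>x. x \<noteq> 0 \<longrightarrow> 0 < x \<bullet> (P *v x))"

definition neg_def :: "real^'n^'n \<Rightarrow> bool"
  where "neg_def P \<longleftrightarrow> pos_def (- P)"

definition schur :: "real^('a::finite + 'd::finite)^('a + 'd) \<Rightarrow> real^'a^'a"
  where "schur H = subblock Inl Inl H
    - subblock Inl Inr H ** matrix_inv (subblock Inr Inr H) ** subblock Inr Inl H"

definition admissible :: "('z::finite, 'u::finite, 'd::finite) block_matrix \<Rightarrow> bool"
  where "admissible H \<longleftrightarrow> transpose H = H \<and> neg_def (subblock dI dI H)
    \<and> pos_semidef (schur H) \<and> pos_def (subblock Inr Inr (schur H))"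

section \<open>Information states\<close>

text \<open>A continuous function on \<open>M\<close> is represented by a total function that is \<open>undefined\<close>
  outside \<open>M\<close>, so that a function of \<open>r\<close> can only depend on the values of \<open>r\<close> on \<open>M\<close>.\<close>

type_synonym ('z, 'u, 'd) info = "('z, 'u, 'd) block_matrix \<Rightarrow> real"

definition info_states :: "('z::finite, 'u::finite, 'd::finite) block_matrix set
    \<Rightarrow> ('z, 'u, 'd) info set"
  where "info_states M = {r \<in> extensional M. continuous_on M r}"

definition info_step :: "('z::finite, 'u::finite, 'd::finite) block_matrix set
    \<Rightarrow> ('z, 'u, 'd) info \<Rightarrow> real^'z \<Rightarrow> real^'u \<Rightarrow> real^'d \<Rightarrow> ('z, 'u, 'd) info"
  where "info_step M r z u d = restrict (\<lambda>H. r H + sigma H z u d) M"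

definition running_cost :: "('z::finite, 'u::finite, 'd::finite) block_matrix
    \<Rightarrow> (nat \<Rightarrow> real^'z) \<Rightarrow> (nat \<Rightarrow> real^'u) \<Rightarrow> (nat \<Rightarrow> real^'d) \<Rightarrow> nat \<Rightarrow> real"
  where "running_cost H z u d t = (\<Sum>s<t. sigma H (z s) (u s) (d s))"

definition info_at :: "('z::finite, 'u::finite, 'd::finite) block_matrix set
    \<Rightarrow> (nat \<Rightarrow> real^'z) \<Rightarrow> (nat \<Rightarrow> real^'u) \<Rightarrow> (nat \<Rightarrow> real^'d) \<Rightarrow> nat \<Rightarrow> ('z, 'u, 'd) info"
  where "info_at M z u d t = restrict (\<lambda>H. running_cost H z u d t) M"

definition info_zero :: "('z::finite, 'u::finite, 'd::finite) block_matrix set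
    \<Rightarrow> ('z, 'u, 'd) info"
  where "info_zero M = restrict (\<lambda>_. 0) M"

section \<open>Bellman operators\<close>

type_synonym ('z, 'u, 'd) value_fun = "real^'z \<Rightarrow> ('z, 'u, 'd) info \<Rightarrow> ereal"
type_synonym ('z, 'u, 'd) control_law = "real^'z \<Rightarrow> ('z, 'u, 'd) info \<Rightarrow> real^'u"

definition real_value :: "(real^'z \<Rightarrow> ('z, 'u, 'd) info \<Rightarrow> real) \<Rightarrow> ('z, 'u, 'd) value_fun"
  where "real_value V z r = ereal (V z r)"

definition le_value :: "('z::finite, 'u::finite, 'd::finite) block_matrix set
    \<Rightarrow> ('z, 'u, 'd) value_fun \<Rightarrow> ('z, 'u, 'd) value_fun \<Rightarrow> bool"
  where "le_value M V W \<longleftrightarrow> (\<forall>z. \<forall>r\<in>info_states M. V z r \<le> W z r)"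

definition bellman_input :: "real^'z^'z \<Rightarrow> real^'u^'z \<Rightarrow> real^'d^'z
    \<Rightarrow> ('z::finite, 'u::finite, 'd::finite) block_matrix set
    \<Rightarrow> real^'u \<Rightarrow> ('z, 'u, 'd) value_fun \<Rightarrow> ('z, 'u, 'd) value_fun"
  where "bellman_input A B G M u V z r =
    (SUP d. V (A *v z + B *v u + G *v d) (info_step M r z u d))"

definition bellman :: "real^'z^'z \<Rightarrow> real^'u^'z \<Rightarrow> real^'d^'z
    \<Rightarrow> ('z::finite, 'u::finite, 'd::finite) block_matrix set
    \<Rightarrow> ('z, 'u, 'd) value_fun \<Rightarrow> ('z, 'u, 'd) value_fun"
  where "bellman A B G M V z r = (INF u. bellman_input A B G M u V z r)"

definition bellman_law :: "real^'z^'z \<Rightarrow> real^'u^'z \<Rightarrow> real^'d^'z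
    \<Rightarrow> ('z::finite, 'u::finite, 'd::finite) block_matrix set
    \<Rightarrow> ('z, 'u, 'd) control_law \<Rightarrow> ('z, 'u, 'd) value_fun \<Rightarrow> ('z, 'u, 'd) value_fun"
  where "bellman_law A B G M \<eta> V z r = bellman_input A B G M (\<eta> z r) V z r"

definition bellman_laws :: "real^'z^'z \<Rightarrow> real^'u^'z \<Rightarrow> real^'d^'z
    \<Rightarrow> ('z::finite, 'u::finite, 'd::finite) block_matrix set
    \<Rightarrow> ('z, 'u, 'd) control_law list \<Rightarrow> ('z, 'u, 'd) value_fun \<Rightarrow> ('z, 'u, 'd) value_fun"
  where "bellman_laws A B G M \<eta>s V = foldr (bellman_law A B G M) \<eta>s V"

definition initial_value :: "('z::finite, 'u::finite, 'd::finite) block_matrix set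
    \<Rightarrow> ('z, 'u, 'd) value_fun"
  where "initial_value M z r = (SUP H\<in>M. ereal (r H))"

definition value_iteration :: "real^'z^'z \<Rightarrow> real^'u^'z \<Rightarrow> real^'d^'z
    \<Rightarrow> ('z::finite, 'u::finite, 'd::finite) block_matrix set
    \<Rightarrow> nat \<Rightarrow> ('z, 'u, 'd) value_fun"
  where "value_iteration A B G M k = (bellman A B G M ^^ k) (initial_value M)"

section \<open>Policies and closed-loop cost\<close>

text \<open>The lists passed to \<open>\<mu> t\<close> are \<open>[z\<^sub>0, \<dots>, z\<^sub>t]\<close>, \<open>[u\<^sub>0, \<dots>, u\<^sub>t\<^sub>-\<^sub>1]\<close> and \<open>[d\<^sub>0, \<dots>, d\<^sub>t\<^sub>-\<^sub>1]\<close>.\<close>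

type_synonym ('z, 'u, 'd) policy =
  "nat \<Rightarrow> (real^'z) list \<Rightarrow> (real^'u) list \<Rightarrow> (real^'d) list \<Rightarrow> real^'u"

primrec closed_loop :: "real^'z^'z \<Rightarrow> real^'u^'z \<Rightarrow> real^'d^'z \<Rightarrow> ('z, 'u, 'd) policy
    \<Rightarrow> real^'z \<Rightarrow> (nat \<Rightarrow> real^'d) \<Rightarrow> nat \<Rightarrow> (real^'z::finite) list \<times> (real^'u::finite) list"
  where
    "closed_loop A B G \<mu> z0 d 0 = ([z0], [])"
  | "closed_loop A B G \<mu> z0 d (Suc t) =
      (let (zs, us) = closed_loop A B G \<mu> z0 d t;
           u = \<mu> t zs us (map d [0..<t])
       in (zs @ [A *v last zs + B *v u + G *v d t], us @ [u]))"

definition state :: "real^'z^'z \<Rightarrow> real^'u^'z \<Rightarrow> real^'d^'z \<Rightarrow> ('z, 'u, 'd) policy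
    \<Rightarrow> real^'z \<Rightarrow> (nat \<Rightarrow> real^'d) \<Rightarrow> nat \<Rightarrow> real^'z::finite"
  where "state A B G \<mu> z0 d t = last (fst (closed_loop A B G \<mu> z0 d t))"

definition input :: "real^'z^'z \<Rightarrow> real^'u^'z \<Rightarrow> real^'d^'z \<Rightarrow> ('z, 'u, 'd) policy
    \<Rightarrow> real^'z \<Rightarrow> (nat \<Rightarrow> real^'d) \<Rightarrow> nat \<Rightarrow> real^'u::finite"
  where "input A B G \<mu> z0 d t = last (snd (closed_loop A B G \<mu> z0 d (Suc t)))"

definition cost :: "real^'z^'z \<Rightarrow> real^'u^'z \<Rightarrow> real^'d^'z \<Rightarrow> ('z, 'u, 'd) policy
    \<Rightarrow> nat \<Rightarrow> real^'z \<Rightarrow> ('z::finite, 'u::finite, 'd::finite) block_matrix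
    \<Rightarrow> (nat \<Rightarrow> real^'d) \<Rightarrow> real"
  where "cost A B G \<mu> N z0 H d =
    running_cost H (state A B G \<mu> z0 d) (input A B G \<mu> z0 d) d N"

definition worst_case_cost :: "real^'z^'z \<Rightarrow> real^'u^'z \<Rightarrow> real^'d^'z
    \<Rightarrow> ('z::finite, 'u::finite, 'd::finite) block_matrix set
    \<Rightarrow> ('z, 'u, 'd) policy \<Rightarrow> real^'z \<Rightarrow> ereal"
  where "worst_case_cost A B G M \<mu> z0 =
    (SUP H\<in>M. SUP d. SUP N. ereal (cost A B G \<mu> N z0 H d))"

section \<open>Periodic control laws\<close>

text \<open>The tuple returned by a supervisor is a list, so entry \<open>s\<close> of the list is the law
  with one-based index \<open>s + 1\<close>.\<close>

type_synonym ('z, 'u, 'd) supervisor =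
  "real^'z \<Rightarrow> ('z, 'u, 'd) info \<Rightarrow> ('z, 'u, 'd) control_law list"

definition periodic_law :: "('z::finite, 'u::finite, 'd::finite) block_matrix set
    \<Rightarrow> nat \<Rightarrow> ('z, 'u, 'd) supervisor \<Rightarrow> bool"
  where "periodic_law M \<tau> \<eta> \<longleftrightarrow> (\<forall>z. \<forall>r\<in>info_states M. length (\<eta> z r) = \<tau>)"

definition periodic_policy :: "('z::finite, 'u::finite, 'd::finite) block_matrix set
    \<Rightarrow> nat \<Rightarrow> ('z, 'u, 'd) supervisor \<Rightarrow> ('z, 'u, 'd) policy"
  where "periodic_policy M \<tau> \<eta> t zs us ds =
    (let r = info_at M ((!) zs) ((!) us) ((!) ds);
         t0 = \<tau> * (t div \<tau>)
     in (\<eta> (zs ! t0) (r t0) ! (t mod \<tau>)) (zs ! t) (r t))"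

definition bellman_periodic :: "real^'z^'z \<Rightarrow> real^'u^'z \<Rightarrow> real^'d^'z
    \<Rightarrow> ('z::finite, 'u::finite, 'd::finite) block_matrix set
    \<Rightarrow> ('z, 'u, 'd) supervisor \<Rightarrow> ('z, 'u, 'd) value_fun \<Rightarrow> ('z, 'u, 'd) value_fun"
  where "bellman_periodic A B G M \<eta> V z r = bellman_laws A B G M (\<eta> z r) V z r"

end

theory Submission
  imports Defs
begin

text \<open>
  Everything rests on one consequence of admissibility: for each \<open>H\<close>, \<open>z\<close>, \<open>u\<close> the
  adversary has a disturbance making the stage cost nonnegative. It is the stationary point of
  the stage cost in \<open>d\<close>, where the stage cost equals the Schur complement form, which is
  positive semidefinite (\<open>admissible_nonneg_stage_cost\<close>). Hence the adversary can always keep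
  what it has gained so far, that is, \<open>V\<^sub>0 \<le> \<B>\<^sub>u V\<^sub>0\<close> for every input \<open>u\<close>
  (\<open>initial_value_le_bellman_input\<close>). All operators are monotone, so \<open>V\<^sub>0 \<le> \<B> V\<^sub>0\<close> makes the value
  iteration increasing, and \<open>V\<^sub>0 \<le> V\<close> implies \<open>V\<^sub>0 \<le> \<B>\<^bsub>\<eta>\<^sub>1\<^esub> \<dots> \<B>\<^bsub>\<eta>\<^sub>k\<^esub> V\<close> for any control laws.

  Let \<open>V\<close> be the given upper bound of \<open>V\<^sub>0\<close>. If \<open>\<B>\<^sup>\<tau> V \<le> V\<close>, then
  \<open>V\<^sub>k \<le> V\<^bsub>\<tau>k\<^esub> \<le> \<B>\<^sup>\<tau>\<^sup>k V \<le> V\<close>, so the value iteration is increasing and bounded by a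
  finite function, and it converges.

  For a periodic law, choosing the input by a law instead of optimally can only increase the value,
  so \<open>\<B>\<^sup>\<tau> V \<le> V\<close> follows at once. For the cost, a Bellman operator of a law dominates what any
  particular disturbance produces, so along every closed-loop trajectory the value of the laws that remain in
  the current period never increases (\<open>bellman_laws_trajectory\<close>). Over a full period the
  assumption closes the loop, so \<open>V\<close> does not increase from one period boundary to the next and
  stays below \<open>V(z\<^sub>0, 0)\<close>. At an intermediate time, \<open>V\<^sub>0\<close> of the information state, which bounds
  the accumulated cost for every \<open>H\<close>, is below the value of the remaining laws, hence below \<open>V\<close> at the last
  boundary. The cost is therefore at most \<open>V(z\<^sub>0, 0)\<close>, which is one member of the maximum.
\<close>

section \<open>Nonnegative stage costs from the Schur complement\<close>

lemma sum_UNIV_Plus: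
  fixes f :: "'a::finite + 'b::finite \<Rightarrow> 'c::comm_monoid_add"
  shows "(\<Sum>x\<in>UNIV. f x) = (\<Sum>a\<in>UNIV. f (Inl a)) + (\<Sum>b\<in>UNIV. f (Inr b))"
  by (simp add: UNIV_Plus_UNIV[symmetric] sum.Plus del: UNIV_Plus_UNIV)

text \<open>The Schur complement with respect to \<open>d\<close> treats \<open>z\<close> and \<open>u\<close> as one vector, so the stage
  cost is rewritten as a form in two blocks.\<close>

lemma sigma_two_blocks:
  fixes H :: "('z::finite, 'u::finite, 'd::finite) block_matrix"
  defines "x \<equiv> \<lambda>z u. (\<chi> i. case i of Inl a \<Rightarrow> z $ a | Inr b \<Rightarrow> u $ b) :: real^('z + 'u)"
  shows "sigma H z u d = x z u \<bullet> (subblock Inl Inl H *v x z u) + x z u \<bullet> (subblock Inl Inr H *v d)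
    + d \<bullet> (subblock Inr Inl H *v x z u) + d \<bullet> (subblock Inr Inr H *v d)"
  unfolding sigma_def subblock_def x_def inner_vec_def matrix_vector_mult_def
  by (simp add: sum_UNIV_Plus sum.distrib distrib_left)

lemma neg_def_invertible:
  fixes P :: "real^'n^'n"
  assumes "neg_def P"
  shows "P ** matrix_inv P = mat 1"
proof -
  have "x = 0" if "P *v x = 0" for x
  proof (rule ccontr)
    assume "x \<noteq> 0"
    then have "0 < x \<bullet> ((- P) *v x)"
      using assms unfolding neg_def_def pos_def_def by blast
    moreover have "(- P) *v x = 0"
      using that matrix_vector_mult_diff_rdistrib[of 0 P x] by simp
    ultimately show False by simp
  qed
  then have "invertible P"
    using matrix_left_invertible_ker[of P] invertible_left_inverse by blast
  then show ?thesis
    unfolding invertible_def matrix_inv_def by (metis (mono_tags, lifting) someI_ex)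
qed

text \<open>At \<open>d = - (H\<^sup>d\<^sup>d)\<^sup>-\<^sup>1 H\<^sup>d\<^sup>x x\<close> one has \<open>H\<^sup>d\<^sup>d d = - H\<^sup>d\<^sup>x x\<close>, so the last two terms of the form
  cancel and the first two are the Schur complement by definition.\<close>

lemma schur_completion:
  fixes H :: "real^('a::finite + 'd::finite)^('a + 'd)"
  defines "d \<equiv> \<lambda>x. - (matrix_inv (subblock Inr Inr H) *v (subblock Inr Inl H *v x))"
  assumes "neg_def (subblock Inr Inr H)"
  shows "x \<bullet> (subblock Inl Inl H *v x) + x \<bullet> (subblock Inl Inr H *v d x)
    + d x \<bullet> (subblock Inr Inl H *v x) + d x \<bullet> (subblock Inr Inr H *v d x)
    = x \<bullet> (schur H *v x)"
proof -
  have neg: "N *v (- y) = - (N *v y)" for N :: "real^'d^'m" and y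
    using matrix_vector_mult_diff_distrib[of N 0 y] by simp
  have "subblock Inr Inr H *v d x = - (subblock Inr Inl H *v x)"
    unfolding d_def
    by (simp add: neg matrix_vector_mul_assoc matrix_mul_assoc neg_def_invertible[OF assms(2)])
  moreover have "schur H *v x = subblock Inl Inl H *v x + subblock Inl Inr H *v d x"
    unfolding schur_def d_def
    by (simp add: neg matrix_vector_mult_diff_rdistrib matrix_vector_mul_assoc matrix_mul_assoc)
  ultimately show ?thesis
    by (simp add: inner_add_right)
qed

lemma admissible_nonneg_stage_cost:
  fixes H :: "('z::finite, 'u::finite, 'd::finite) block_matrix"
  assumes "admissible H"
  obtains d where "0 \<le> sigma H z u d"
proof -
  have neg: "neg_def (subblock Inr Inr H)" and psd: "pos_semidef (schur H)"
    using assms unfolding admissible_def by auto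
  show thesis
  proof (rule that)
    show "0 \<le> sigma H z u (- (matrix_inv (subblock Inr Inr H) *v (subblock Inr Inl H *v
        (\<chi> i. case i of Inl a \<Rightarrow> z $ a | Inr b \<Rightarrow> u $ b))))"
      unfolding sigma_two_blocks schur_completion[OF neg]
      using psd unfolding pos_semidef_def by blast
  qed
qed

section \<open>Information states\<close>

lemma continuous_on_sigma: "continuous_on S (\<lambda>H. sigma H z u d)"
  unfolding sigma_def subblock_def inner_vec_def matrix_vector_mult_def
  by (auto intro!: continuous_intros)

text \<open>Value functions are compared on continuous information states only, so the dynamics must not
  leave them.\<close>

lemma info_step_in_info_states:
  assumes "r \<in> info_states M"
  shows "info_step M r z u d \<in> info_states M"
proof -
  have "continuous_on M (\<lambda>H. r H + sigma H z u d)"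
    using assms unfolding info_states_def
    by (auto intro!: continuous_on_add continuous_on_sigma)
  then have "continuous_on M (info_step M r z u d)"
    unfolding info_step_def by (rule continuous_on_eq) simp
  then show ?thesis
    unfolding info_states_def by (simp add: info_step_def)
qed

lemma info_zero_in_info_states: "info_zero M \<in> info_states M"
proof -
  have "continuous_on M (info_zero M)"
    unfolding info_zero_def by (rule continuous_on_eq[OF continuous_on_const]) simp
  then show ?thesis
    unfolding info_states_def by (simp add: info_zero_def)
qed

lemma info_at_0: "info_at M z u d 0 = info_zero M"
  by (simp add: info_at_def info_zero_def running_cost_def)

lemma info_at_Suc: "info_at M z u d (Suc t) = info_step M (info_at M z u d t) (z t) (u t) (d t)"
  by (auto simp: info_at_def info_step_def running_cost_def restrict_def)

lemma info_at_in_info_states: "info_at M z u d t \<in> info_states M"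
  by (induction t) (simp_all add: info_at_0 info_at_Suc info_zero_in_info_states info_step_in_info_states)

lemma info_at_cong:
  assumes "\<And>s. s < t \<Longrightarrow> z s = z' s \<and> u s = u' s \<and> d s = d' s"
  shows "info_at M z u d t = info_at M z' u' d' t"
  using assms by (auto simp: info_at_def running_cost_def restrict_def intro!: sum.cong)

section \<open>Monotone Bellman operators\<close>

lemma le_value_refl: "le_value M V V"
  by (simp add: le_value_def)

lemma le_value_trans: "le_value M U V \<Longrightarrow> le_value M V W \<Longrightarrow> le_value M U W"
  unfolding le_value_def by (meson order_trans)

lemma bellman_input_mono:
  assumes "le_value M V W"
  shows "le_value M (bellman_input A B G M u V) (bellman_input A B G M u W)"
  unfolding le_value_def bellman_input_def
proof (intro allI ballI SUP_mono')
  fix z r d assume "r \<in> info_states M"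
  then show "V (A *v z + B *v u + G *v d) (info_step M r z u d)
      \<le> W (A *v z + B *v u + G *v d) (info_step M r z u d)"
    using assms info_step_in_info_states unfolding le_value_def by blast
qed

lemma bellman_mono:
  assumes "le_value M V W"
  shows "le_value M (bellman A B G M V) (bellman A B G M W)"
  using bellman_input_mono[OF assms] unfolding le_value_def bellman_def
  by (auto intro!: INF_mono')

lemma funpow_bellman_mono:
  assumes "le_value M V W"
  shows "le_value M ((bellman A B G M ^^ k) V) ((bellman A B G M ^^ k) W)"
  using assms by (induction k) (simp_all add: bellman_mono)

lemma bellman_law_mono:
  assumes "le_value M V W"
  shows "le_value M (bellman_law A B G M \<eta> V) (bellman_law A B G M \<eta> W)"
  using bellman_input_mono[OF assms] unfolding le_value_def bellman_law_def by blast

lemma bellman_le_bellman_law: "le_value M (bellman A B G M V) (bellman_law A B G M \<eta> V)"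
  unfolding le_value_def bellman_def bellman_law_def by (auto intro: INF_lower)

lemma bellman_laws_Nil: "bellman_laws A B G M [] V = V"
  by (simp add: bellman_laws_def)

lemma bellman_laws_Cons:
  "bellman_laws A B G M (\<eta> # \<eta>s) V = bellman_law A B G M \<eta> (bellman_laws A B G M \<eta>s V)"
  by (simp add: bellman_laws_def)

lemma funpow_bellman_le_bellman_laws:
  "le_value M ((bellman A B G M ^^ length \<eta>s) V) (bellman_laws A B G M \<eta>s V)"
proof (induction \<eta>s)
  case Nil
  show ?case by (simp add: bellman_laws_Nil le_value_refl)
next
  case (Cons \<eta> \<eta>s)
  show ?case
    using le_value_trans[OF bellman_mono[OF Cons.IH] bellman_le_bellman_law]
    by (simp add: bellman_laws_Cons)
qed

lemma funpow_bellman_le: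
  assumes "le_value M ((bellman A B G M ^^ \<tau>) V) V"
  shows "le_value M ((bellman A B G M ^^ (\<tau> * k)) V) V"
proof (induction k)
  case 0
  show ?case by (simp add: le_value_refl)
next
  case (Suc k)
  have "(bellman A B G M ^^ (\<tau> * Suc k)) V = (bellman A B G M ^^ \<tau>) ((bellman A B G M ^^ (\<tau> * k)) V)"
    by (simp add: funpow_add)
  then show ?case
    using le_value_trans[OF funpow_bellman_mono[OF Suc.IH] assms] by simp
qed

section \<open>The adversary keeps the initial value\<close>

text \<open>Each \<open>H\<close> competing in the supremum \<open>V\<^sub>0\<close> admits a disturbance, depending on \<open>H\<close>, under which
  the value \<open>r(H)\<close> does not decrease; the supremum over disturbances covers all of them.\<close>

lemma initial_value_le_bellman_input:
  assumes "\<forall>H\<in>M. admissible H"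
  shows "initial_value M z r \<le> bellman_input A B G M u (initial_value M) z r"
  unfolding initial_value_def
proof (rule SUP_least)
  fix H assume H: "H \<in> M"
  then obtain d where "0 \<le> sigma H z u d"
    using assms admissible_nonneg_stage_cost by metis
  then have "ereal (r H) \<le> ereal (info_step M r z u d H)"
    using H by (simp add: info_step_def)
  also have "\<dots> \<le> (SUP H\<in>M. ereal (info_step M r z u d H))"
    using H by (rule SUP_upper)
  also have "\<dots> \<le> bellman_input A B G M u (\<lambda>z r. SUP H\<in>M. ereal (r H)) z r"
    unfolding bellman_input_def by (rule SUP_upper) simp
  finally show "ereal (r H) \<le> bellman_input A B G M u (\<lambda>z r. SUP H\<in>M. ereal (r H)) z r" .
qed

lemma initial_value_le_bellman:
  assumes "\<forall>H\<in>M. admissible H"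
  shows "le_value M (initial_value M) (bellman A B G M (initial_value M))"
  unfolding le_value_def bellman_def
  using initial_value_le_bellman_input[OF assms] by (auto intro: INF_greatest)

lemma initial_value_le_bellman_laws:
  assumes "\<forall>H\<in>M. admissible H" and "le_value M (initial_value M) V"
  shows "le_value M (initial_value M) (bellman_laws A B G M \<eta>s V)"
proof (induction \<eta>s)
  case Nil
  show ?case using assms(2) by (simp add: bellman_laws_Nil)
next
  case (Cons \<eta> \<eta>s)
  have "le_value M (initial_value M) (bellman_law A B G M \<eta> (initial_value M))"
    unfolding le_value_def bellman_law_def
    using initial_value_le_bellman_input[OF assms(1)] by blast
  then show ?case
    unfolding bellman_laws_Cons using bellman_law_mono[OF Cons.IH] by (rule le_value_trans)
qed

section \<open>Convergence of the value iteration\<close>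

lemma value_iteration_Suc_ge:
  assumes "\<forall>H\<in>M. admissible H"
  shows "le_value M (value_iteration A B G M k) (value_iteration A B G M (Suc k))"
  using funpow_bellman_mono[OF initial_value_le_bellman[OF assms]]
  by (simp add: value_iteration_def funpow_Suc_right del: funpow.simps(2))

lemma incseq_value_iteration:
  assumes "\<forall>H\<in>M. admissible H" and "r \<in> info_states M"
  shows "incseq (\<lambda>k. value_iteration A B G M k z r)"
  using value_iteration_Suc_ge[OF assms(1)] assms(2)
  by (auto simp: le_value_def intro: incseq_SucI)

text \<open>The assumption on \<open>V\<close> controls the iterates whose index is a multiple of \<open>\<tau>\<close>; monotonicity
  covers the others.\<close>

lemma value_iteration_le:
  assumes "\<forall>H\<in>M. admissible H" and "0 < \<tau>"
    and "le_value M (initial_value M) V"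
    and "le_value M ((bellman A B G M ^^ \<tau>) V) V"
  shows "le_value M (value_iteration A B G M k) V"
  unfolding le_value_def
proof (intro allI ballI)
  fix z r assume r: "r \<in> info_states M"
  have "k \<le> \<tau> * k" using assms(2) by simp
  then have "value_iteration A B G M k z r \<le> value_iteration A B G M (\<tau> * k) z r"
    using incseq_value_iteration[OF assms(1) r] by (rule incseqD[rotated])
  also have "\<dots> \<le> V z r"
    using le_value_trans[OF funpow_bellman_mono[OF assms(3)] funpow_bellman_le[OF assms(4)]] r
    unfolding le_value_def value_iteration_def by blast
  finally show "value_iteration A B G M k z r \<le> V z r" .
qed

lemma incseq_ereal_bounded_LIMSEQ:
  fixes f :: "nat \<Rightarrow> ereal"
  assumes "incseq f" and "- \<infinity> < f 0" and "\<And>k. f k \<le> ereal b"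
  obtains l where "f \<longlonglongrightarrow> ereal l" and "l \<le> b"
proof -
  have "f 0 \<le> (SUP k. f k)" and "(SUP k. f k) \<le> ereal b"
    by (auto intro: SUP_upper SUP_least assms(3))
  with assms(2) obtain l where "(SUP k. f k) = ereal l" and "l \<le> b"
    by (cases "SUP k. f k") auto
  then show thesis
    using that LIMSEQ_SUP[OF assms(1)] by simp
qed

lemma value_iteration_converges:
  assumes "M \<noteq> {}" and "\<forall>H\<in>M. admissible H" and "0 < \<tau>"
    and "le_value M (initial_value M) (real_value V)"
    and "le_value M ((bellman A B G M ^^ \<tau>) (real_value V)) (real_value V)"
  shows "\<exists>L. \<forall>z. \<forall>r\<in>info_states M.
    (\<lambda>k. value_iteration A B G M k z r) \<longlonglongrightarrow> ereal (L z r) \<and> L z r \<le> V z r"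
proof -
  define L where
    "L z r = (SOME l. (\<lambda>k. value_iteration A B G M k z r) \<longlonglongrightarrow> ereal l \<and> l \<le> V z r)" for z r
  have "\<exists>l. (\<lambda>k. value_iteration A B G M k z r) \<longlonglongrightarrow> ereal l \<and> l \<le> V z r"
    if r: "r \<in> info_states M" for z r
  proof -
    obtain H where "H \<in> M" using assms(1) by blast
    then have "ereal (r H) \<le> value_iteration A B G M 0 z r"
      unfolding value_iteration_def initial_value_def by (auto intro: SUP_upper)
    then have "- \<infinity> < value_iteration A B G M 0 z r"
      using less_le_trans[of "- \<infinity>" "ereal (r H)"] by simp
    moreover have "value_iteration A B G M k z r \<le> ereal (V z r)" for k
      using value_iteration_le[OF assms(2-5)] r by (simp add: le_value_def real_value_def)
    ultimately obtain l where
      "(\<lambda>k. value_iteration A B G M k z r) \<longlonglongrightarrow> ereal l" and "l \<le> V z r"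
      by (rule incseq_ereal_bounded_LIMSEQ[OF incseq_value_iteration[OF assms(2) r]])
    then show ?thesis by blast
  qed
  from someI_ex[OF this] have "(\<lambda>k. value_iteration A B G M k z r) \<longlonglongrightarrow> ereal (L z r) \<and> L z r \<le> V z r"
    if "r \<in> info_states M" for z r
    using that unfolding L_def by blast
  then show ?thesis by blast
qed

section \<open>Closed-loop trajectories\<close>

lemma closed_loop_eq:
  "closed_loop A B G \<mu> z0 d t =
    (map (state A B G \<mu> z0 d) [0..<Suc t], map (input A B G \<mu> z0 d) [0..<t])"
proof (induction t)
  case 0
  show ?case by (simp add: state_def)
next
  case (Suc t)
  then show ?case
    using state_def[of A B G \<mu> z0 d "Suc t"] input_def[of A B G \<mu> z0 d t]
    by (simp add: Let_def)
qed

lemma state_0: "state A B G \<mu> z0 d 0 = z0"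
  by (simp add: state_def)

lemma input_eq:
  "input A B G \<mu> z0 d t = \<mu> t (map (state A B G \<mu> z0 d) [0..<Suc t])
    (map (input A B G \<mu> z0 d) [0..<t]) (map d [0..<t])"
  using input_def[of A B G \<mu> z0 d t] by (simp add: closed_loop_eq[of _ _ _ _ _ _ t] Let_def)

lemma state_Suc:
  "state A B G \<mu> z0 d (Suc t) =
    A *v state A B G \<mu> z0 d t + B *v input A B G \<mu> z0 d t + G *v d t"
  using state_def[of A B G \<mu> z0 d "Suc t"]
  by (simp add: closed_loop_eq[of _ _ _ _ _ _ t] Let_def input_eq[of _ _ _ _ _ _ t])

text \<open>The policy reads its information state off finite lists of past values, which determine it
  because the running cost up to \<open>t\<close> only involves times before \<open>t\<close>.\<close>

lemma periodic_input:
  fixes A :: "real^'z::finite^'z" and B :: "real^'u::finite^'z" and G :: "real^'d::finite^'z"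
    and M :: "('z, 'u, 'd) block_matrix set" and \<eta> :: "('z, 'u, 'd) supervisor" and z0 d
  assumes "s < \<tau>"
  defines "x \<equiv> state A B G (periodic_policy M \<tau> \<eta>) z0 d"
    and "v \<equiv> input A B G (periodic_policy M \<tau> \<eta>) z0 d"
  shows "v (\<tau> * k + s) = (\<eta> (x (\<tau> * k)) (info_at M x v d (\<tau> * k)) ! s)
    (x (\<tau> * k + s)) (info_at M x v d (\<tau> * k + s))"
proof -
  let ?t = "\<tau> * k + s"
  have idx: "?t div \<tau> = k" "?t mod \<tau> = s" using assms(1) by auto
  have info: "info_at M ((!) (map x [0..<Suc ?t])) ((!) (map v [0..<?t])) ((!) (map d [0..<?t])) t
      = info_at M x v d t" if "t \<le> ?t" for t
    using that by (intro info_at_cong) (auto simp: nth_append simp del: upt_Suc)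
  have nth: "map x [0..<Suc ?t] ! t = x t" if "t \<le> ?t" for t
    using that by (simp del: upt_Suc)
  have "v ?t = periodic_policy M \<tau> \<eta> ?t (map x [0..<Suc ?t]) (map v [0..<?t]) (map d [0..<?t])"
    unfolding v_def x_def by (rule input_eq)
  also have "\<dots> = (\<eta> (x (\<tau> * k)) (info_at M x v d (\<tau> * k)) ! s)
    (x ?t) (info_at M x v d ?t)"
    unfolding periodic_policy_def Let_def idx
    by (simp add: info nth del: upt_Suc)
  finally show ?thesis .
qed

section \<open>Cost of a periodic law\<close>

text \<open>Each step of a trajectory driven by the laws is one candidate in the supremum over
  disturbances that defines the operator of the current law.\<close>

lemma bellman_laws_trajectory:
  assumes "s \<le> length \<eta>s"
    and "\<And>i. i < s \<Longrightarrow> x (Suc i) = A *v x i + B *v ((\<eta>s ! i) (x i) (r i)) + G *v d i"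
    and "\<And>i. i < s \<Longrightarrow> r (Suc i) = info_step M (r i) (x i) ((\<eta>s ! i) (x i) (r i)) (d i)"
  shows "bellman_laws A B G M (drop s \<eta>s) V (x s) (r s) \<le> bellman_laws A B G M \<eta>s V (x 0) (r 0)"
  using assms
proof (induction s)
  case 0
  show ?case by simp
next
  case (Suc s)
  have drop: "drop s \<eta>s = \<eta>s ! s # drop (Suc s) \<eta>s"
    using Suc.prems(1) by (simp add: Cons_nth_drop_Suc)
  have "bellman_laws A B G M (drop (Suc s) \<eta>s) V (x (Suc s)) (r (Suc s))
      \<le> bellman_laws A B G M (drop s \<eta>s) V (x s) (r s)"
    unfolding drop bellman_laws_Cons bellman_law_def bellman_input_def
      Suc.prems(2)[OF lessI] Suc.prems(3)[OF lessI]
    by (rule SUP_upper) simp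
  also have "\<dots> \<le> bellman_laws A B G M \<eta>s V (x 0) (r 0)"
    using Suc by simp
  finally show ?case .
qed

text \<open>The value of the remaining laws in a period is at most \<open>V\<close> at the start of that period.
  With \<open>s = \<tau>\<close> no law remains, and the bound passes \<open>V\<close> on to the start of the next period.\<close>

lemma periodic_remaining_value_le:
  fixes A :: "real^'z::finite^'z" and B :: "real^'u::finite^'z" and G :: "real^'d::finite^'z"
    and M :: "('z, 'u, 'd) block_matrix set" and \<eta> :: "('z, 'u, 'd) supervisor" and z0 d
  assumes "periodic_law M \<tau> \<eta>"
    and "le_value M (bellman_periodic A B G M \<eta> V) V"
    and "s \<le> \<tau>"
  defines "x \<equiv> state A B G (periodic_policy M \<tau> \<eta>) z0 d"
    and "r \<equiv> info_at M (state A B G (periodic_policy M \<tau> \<eta>) z0 d)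
      (input A B G (periodic_policy M \<tau> \<eta>) z0 d) d"
  shows "bellman_laws A B G M (drop s (\<eta> (x (\<tau> * k)) (r (\<tau> * k)))) V
      (x (\<tau> * k + s)) (r (\<tau> * k + s)) \<le> V (x (\<tau> * k)) (r (\<tau> * k))"
proof -
  let ?v = "input A B G (periodic_policy M \<tau> \<eta>) z0 d"
  let ?\<eta>s = "\<eta> (x (\<tau> * k)) (r (\<tau> * k))"
  have r: "r t \<in> info_states M" for t
    unfolding r_def by (rule info_at_in_info_states)
  have v: "?v (\<tau> * k + i) = (?\<eta>s ! i) (x (\<tau> * k + i)) (r (\<tau> * k + i))" if "i < s" for i
    using periodic_input[of i \<tau>] that assms(3) unfolding x_def r_def by simp
  have "bellman_laws A B G M (drop s ?\<eta>s) V (x (\<tau> * k + s)) (r (\<tau> * k + s))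
      \<le> bellman_laws A B G M ?\<eta>s V (x (\<tau> * k + 0)) (r (\<tau> * k + 0))"
  proof (rule bellman_laws_trajectory)
    show "s \<le> length ?\<eta>s"
      using assms(1,3) r unfolding periodic_law_def by simp
    show "x (\<tau> * k + Suc i) = A *v x (\<tau> * k + i)
        + B *v ((?\<eta>s ! i) (x (\<tau> * k + i)) (r (\<tau> * k + i))) + G *v d (\<tau> * k + i)"
      if "i < s" for i
      unfolding v[OF that, symmetric] unfolding x_def by (simp add: state_Suc)
    show "r (\<tau> * k + Suc i) = info_step M (r (\<tau> * k + i)) (x (\<tau> * k + i))
        ((?\<eta>s ! i) (x (\<tau> * k + i)) (r (\<tau> * k + i))) (d (\<tau> * k + i))"
      if "i < s" for i
      unfolding v[OF that, symmetric] unfolding x_def r_def by (simp add: info_at_Suc)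
  qed
  also have "\<dots> \<le> V (x (\<tau> * k)) (r (\<tau> * k))"
    using assms(2) r by (simp add: le_value_def bellman_periodic_def)
  finally show ?thesis .
qed

lemma worst_case_cost_periodic_le:
  assumes "\<forall>H\<in>M. admissible H" and "0 < \<tau>"
    and "le_value M (initial_value M) V"
    and "periodic_law M \<tau> \<eta>"
    and "le_value M (bellman_periodic A B G M \<eta> V) V"
  shows "worst_case_cost A B G M (periodic_policy M \<tau> \<eta>) z0 \<le> V z0 (info_zero M)"
  unfolding worst_case_cost_def
proof (intro SUP_least)
  fix H d N assume H: "H \<in> M"
  let ?x = "state A B G (periodic_policy M \<tau> \<eta>) z0 d"
  let ?v = "input A B G (periodic_policy M \<tau> \<eta>) z0 d"
  let ?r = "info_at M ?x ?v d"
  note remaining = periodic_remaining_value_le[OF assms(4,5)]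
  have boundary: "V (?x (\<tau> * k)) (?r (\<tau> * k)) \<le> V z0 (info_zero M)" for k
  proof (induction k)
    case 0
    show ?case by (simp add: state_0 info_at_0)
  next
    case (Suc k)
    have "length (\<eta> (?x (\<tau> * k)) (?r (\<tau> * k))) = \<tau>"
      using assms(4) info_at_in_info_states unfolding periodic_law_def by blast
    then have "V (?x (\<tau> * Suc k)) (?r (\<tau> * Suc k)) \<le> V (?x (\<tau> * k)) (?r (\<tau> * k))"
      using remaining[of \<tau> z0 d k] by (simp add: bellman_laws_Nil add.commute)
    also note Suc.IH
    finally show ?case .
  qed
  define k s where "k = N div \<tau>" and "s = N mod \<tau>"
  have N: "N = \<tau> * k + s" and s: "s \<le> \<tau>"
    using assms(2) by (simp_all add: k_def s_def less_imp_le)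
  have "ereal (cost A B G (periodic_policy M \<tau> \<eta>) N z0 H d) = ereal (?r N H)"
    using H by (simp add: cost_def info_at_def)
  also have "\<dots> \<le> initial_value M (?x N) (?r N)"
    unfolding initial_value_def using H by (rule SUP_upper)
  also have "\<dots> \<le> bellman_laws A B G M (drop s (\<eta> (?x (\<tau> * k)) (?r (\<tau> * k)))) V (?x N) (?r N)"
    using initial_value_le_bellman_laws[OF assms(1,3)] info_at_in_info_states
    unfolding le_value_def by blast
  also have "\<dots> \<le> V (?x (\<tau> * k)) (?r (\<tau> * k))"
    unfolding N by (rule remaining[OF s])
  also note boundary
  finally show "ereal (cost A B G (periodic_policy M \<tau> \<eta>) N z0 H d) \<le> V z0 (info_zero M)" .
qed

lemma funpow_bellman_le_of_periodic:
  assumes "periodic_law M \<tau> \<eta>"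
    and "le_value M (bellman_periodic A B G M \<eta> V) V"
  shows "le_value M ((bellman A B G M ^^ \<tau>) V) V"
  unfolding le_value_def
proof (intro allI ballI)
  fix z r assume r: "r \<in> info_states M"
  have "length (\<eta> z r) = \<tau>"
    using assms(1) r by (simp add: periodic_law_def)
  then have "(bellman A B G M ^^ \<tau>) V z r \<le> bellman_periodic A B G M \<eta> V z r"
    using funpow_bellman_le_bellman_laws[where \<eta>s = "\<eta> z r"] r
    by (simp add: le_value_def bellman_periodic_def)
  also have "\<dots> \<le> V z r"
    using assms(2) r by (simp add: le_value_def)
  finally show "(bellman A B G M ^^ \<tau>) V z r \<le> V z r" .
qed

theorem theorem5:
  fixes A :: "real^'z^'z" and B :: "real^'u^'z" and G :: "real^'d^'z"
    and z0 :: "real^'z"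
    and M :: "('z::finite, 'u::finite, 'd::finite) block_matrix set"
    and Vbar :: "real^'z \<Rightarrow> ('z, 'u, 'd) info \<Rightarrow> real"
    and \<tau> :: nat
  assumes "M \<noteq> {}" and "compact M" and "\<forall>H\<in>M. admissible H"
    and "0 < \<tau>"
    and "le_value M (initial_value M) (real_value Vbar)"
  shows "(le_value M ((bellman A B G M ^^ \<tau>) (real_value Vbar)) (real_value Vbar) \<longrightarrow>
      (\<exists>Vstar :: real^'z \<Rightarrow> ('z, 'u, 'd) info \<Rightarrow> real. \<forall>z. \<forall>r\<in>info_states M.
        (\<lambda>k. value_iteration A B G M k z r) \<longlonglongrightarrow> ereal (Vstar z r) \<and> Vstar z r \<le> Vbar z r))
    \<and>
    (\<forall>\<eta>. periodic_law M \<tau> \<eta> \<and>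
        le_value M (bellman_periodic A B G M \<eta> (real_value Vbar)) (real_value Vbar) \<longrightarrow>
      le_value M ((bellman A B G M ^^ \<tau>) (real_value Vbar)) (real_value Vbar) \<and>
      worst_case_cost A B G M (periodic_policy M \<tau> \<eta>) z0
        \<le> Max ((\<lambda>s. bellman_laws A B G M (drop s (\<eta> z0 (info_zero M))) (real_value Vbar)
                  z0 (info_zero M)) ` {1..\<tau>}))"
proof (intro conjI impI allI; (elim conjE)?)
  assume "le_value M ((bellman A B G M ^^ \<tau>) (real_value Vbar)) (real_value Vbar)"
  then show "\<exists>Vstar :: real^'z \<Rightarrow> ('z, 'u, 'd) info \<Rightarrow> real. \<forall>z. \<forall>r\<in>info_states M.
      (\<lambda>k. value_iteration A B G M k z r) \<longlonglongrightarrow> ereal (Vstar z r) \<and> Vstar z r \<le> Vbar z r"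
    using assms value_iteration_converges by blast
next
  fix \<eta>
  assume \<eta>: "periodic_law M \<tau> \<eta>"
    "le_value M (bellman_periodic A B G M \<eta> (real_value Vbar)) (real_value Vbar)"
  show "le_value M ((bellman A B G M ^^ \<tau>) (real_value Vbar)) (real_value Vbar)"
    using \<eta> by (rule funpow_bellman_le_of_periodic)
  let ?W = "\<lambda>s. bellman_laws A B G M (drop s (\<eta> z0 (info_zero M))) (real_value Vbar)
    z0 (info_zero M)"
  have "length (\<eta> z0 (info_zero M)) = \<tau>"
    using \<eta>(1) info_zero_in_info_states unfolding periodic_law_def by blast
  \<comment> \<open>The entry with index \<open>\<tau>\<close> drops all laws and leaves the value function itself.\<close>
  then have "real_value Vbar z0 (info_zero M) = ?W \<tau>"
    by (simp add: bellman_laws_Nil)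
  also have "\<dots> \<le> Max (?W ` {1..\<tau>})"
    using assms(4) by (intro Max_ge) auto
  finally show "worst_case_cost A B G M (periodic_policy M \<tau> \<eta>) z0 \<le> Max (?W ` {1..\<tau>})"
    using worst_case_cost_periodic_le[OF assms(3,4,5) \<eta>] order_trans by blast
qed

end
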